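(* Let $S$ be a (non-empty) subsemigroup of $\mathbb{R}^n$ with the property that whenever a linear form $l:\mathbb{R}^n\to\mathbb{R}$ has a positive value on $S$ it also has a negative value on $S$. Then the closure of $S$ is a subgroup of $\mathbb{R}^n$.
   Context: $\mathbb{R}^n$ is considered as an additive group with the Euclidean topology; a subsemigroup is a subset closed under addition. *)

theory Defs
  imports "HOL-Analysis.Analysis" "HOL-Algebra.Group"
begin

definition additive_group :: "'a::ab_group_add monoid" where
  "additive_group = \<lparr>carrier = UNIV, mult = (+), one = 0\<rparr>"

text \<open>The empty set is allowed; non-emptiness is a separate hypothesis where it is needed.\<close>

definition subsemigroup :: "'a set \<Rightarrow> ('a, 'b) monoid_scheme \<Rightarrow> bool" where
  "subsemigroup S G \<longleftrightarrow>
     S \<subseteq> carrier G \<and> (\<forall>x\<in>S. \<forall>y\<in>S. x \<otimes>\<^bsub>G\<^esub> y \<in> S)"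

lemma group_additive_group: "group (additive_group :: 'a::ab_group_add monoid)"
  by (rule groupI) (auto simp: additive_group_def add.assoc intro: exI[of _ "- x" for x] left_minus)

lemma subsemigroup_additive_group_iff:
  "subsemigroup S (additive_group :: 'a::ab_group_add monoid) \<longleftrightarrow>
     (\<forall>x\<in>S. \<forall>y\<in>S. x + y \<in> S)"
  by (simp add: subsemigroup_def additive_group_def)

end

theory Submission imports Defs begin

text \<open>
  The point is that \<^term>\<open>- x\<close> lies in the closure of \<^term>\<open>S\<close> for every \<^term>\<open>x\<close> in the
  semigroup \<^term>\<open>S\<close>; everything else follows from continuity of addition and negation.

  The hypothesis on linear forms says that no closed half-space bounded by a hyperplane through the
  origin contains \<^term>\<open>S\<close>, unless the hyperplane itself contains \<^term>\<open>S\<close>. By separation, the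
  closed convex cone generated by \<^term>\<open>S\<close> then contains \<^term>\<open>- S\<close>, so it is a linear subspace.
  In finite dimension, a convex set whose closure is a subspace is already closed, so \<^term>\<open>- x\<close> is an exact nonnegative
  combination \<open>\<Sum> u v *\<^sub>R v\<close> of finitely many elements of \<^term>\<open>S\<close>
  (lemma \<open>uminus_mem_convex_cone_hull\<close>).

  Exactness matters for the arithmetic step: the relation \<open>x + \<Sum> u v *\<^sub>R v = 0\<close> may be multiplied
  by any positive integer \<^term>\<open>q\<close> without creating an error. Dirichlet's simultaneous approximation
  theorem supplies a \<^term>\<open>q\<close> for which all coefficients \<open>q * u v\<close> are within an arbitrarily small
  distance of integers, necessarily nonnegative ones. Rounding the coefficients of the elements
  \<^term>\<open>v\<close>, and leaving out one copy of \<^term>\<open>x\<close>, gives an element of \<^term>\<open>S\<close> that is close to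
  \<^term>\<open>- x\<close> (lemma \<open>uminus_mem_closure_if_uminus_mem_cone\<close>).
\<close>

text \<open>
  A semigroup need not contain \<open>0\<close>, which is the value of the combination when all
  coefficients vanish; the summand \<^term>\<open>x\<close> avoids this case.
\<close>

lemma add_nat_combination_mem:
  fixes S :: "'a::real_vector set"
  assumes add: "\<And>x y. x \<in> S \<Longrightarrow> y \<in> S \<Longrightarrow> x + y \<in> S"
    and "finite F" "F \<subseteq> S" "x \<in> S"
  shows "x + (\<Sum>v\<in>F. real (k v) *\<^sub>R v) \<in> S"
  using \<open>finite F\<close> \<open>F \<subseteq> S\<close>
proof (induction F)
  case empty
  then show ?case using \<open>x \<in> S\<close> by simp
next
  case (insert v F)
  have add_multiple: "y + real n *\<^sub>R v \<in> S" if "y \<in> S" for y n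
  proof (induction n)
    case (Suc n)
    then have "(y + real n *\<^sub>R v) + v \<in> S" using add insert.prems by blast
    then show ?case by (simp add: algebra_simps)
  qed (use that in simp)
  from insert add_multiple[of "x + (\<Sum>v\<in>F. real (k v) *\<^sub>R v)" "k v"]
  show ?case by (simp add: algebra_simps)
qed

lemma Dirichlet_approx_simult_finite:
  fixes \<theta> :: "'a \<Rightarrow> real" and N :: nat
  assumes "finite F" "N > 0"
  obtains q :: int and p :: "'a \<Rightarrow> int"
    where "q > 0" "\<And>v. v \<in> F \<Longrightarrow> \<bar>of_int q * \<theta> v - of_int (p v)\<bar> < 1 / N"
proof -
  obtain h where h: "bij_betw h {0..<card F} F"
    using ex_bij_betw_nat_finite[OF \<open>finite F\<close>] by blast
  obtain q p where q: "0 < q"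
    and p: "\<And>i. i < card F \<Longrightarrow> \<bar>of_int q * (\<theta> \<circ> h) i - of_int (p i)\<bar> < 1 / N"
    using Dirichlet_approx_simult[OF \<open>N > 0\<close>, of "card F" "\<theta> \<circ> h"] by metis
  show thesis
  proof (rule that[OF q])
    fix v assume "v \<in> F"
    then obtain i where "i < card F" "v = h i"
      using h by (force simp: bij_betw_def)
    moreover have "the_inv_into {0..<card F} h (h i) = i" if "i < card F" for i
      using h that by (simp add: bij_betw_def the_inv_into_f_f)
    ultimately show "\<bar>of_int q * \<theta> v - of_int ((p \<circ> the_inv_into {0..<card F} h) v)\<bar> < 1 / N"
      using p by simp
  qed
qed

text \<open>
  The cone is the set of nonnegative multiples of convex combinations; the multiplier is absorbed
  into the coefficients.
\<close>

lemma convex_cone_hull_imp_nonneg_combination: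
  fixes S :: "'a::real_vector set"
  assumes "S \<noteq> {}" "y \<in> convex_cone hull S"
  obtains F u where "finite F" "F \<subseteq> S" "\<And>v. v \<in> F \<Longrightarrow> u v \<ge> 0" "y = (\<Sum>v\<in>F. u v *\<^sub>R v)"
proof -
  obtain c z where c: "c \<ge> 0" "z \<in> convex hull S" "y = c *\<^sub>R z"
    using assms by (auto simp: convex_cone_hull_separate_nonempty conic_hull_explicit)
  obtain F u where F: "finite F" "F \<subseteq> S" "\<forall>v\<in>F. 0 \<le> u v" "(\<Sum>v\<in>F. u v *\<^sub>R v) = z"
    using c(2) unfolding convex_hull_explicit by blast
  show thesis
    by (rule that[of F "\<lambda>v. c * u v"]) (use F c in \<open>auto simp: scaleR_right.sum\<close>)
qed

text \<open>
  The arithmetic half of the proof: Dirichlet approximation turns real coefficients into natural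
  ones at the price of an arbitrarily small error. It works in every normed space, since only
  finitely many elements of \<^term>\<open>S\<close> are involved.
\<close>

lemma uminus_mem_closure_if_uminus_mem_cone:
  fixes S :: "'a::real_normed_vector set"
  assumes add: "\<And>x y. x \<in> S \<Longrightarrow> y \<in> S \<Longrightarrow> x + y \<in> S"
    and "x \<in> S" "- x \<in> convex_cone hull S"
  shows "- x \<in> closure S"
  unfolding closure_approachable
proof (intro allI impI)
  fix e :: real assume "e > 0"
  obtain F u where F: "finite F" "F \<subseteq> S" "\<And>v. v \<in> F \<Longrightarrow> u v \<ge> 0"
    and comb: "- x = (\<Sum>v\<in>F. u v *\<^sub>R v)"
    using convex_cone_hull_imp_nonneg_combination[OF _ assms(3)] \<open>x \<in> S\<close> by blast
  obtain N :: nat where N: "(\<Sum>v\<in>F. norm v) / e < real N"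
    using reals_Archimedean2 by blast
  moreover have "(\<Sum>v\<in>F. norm v) / e \<ge> 0"
    using \<open>e > 0\<close> by (simp add: sum_nonneg)
  ultimately have "N > 0" by linarith
  \<comment> \<open>The relation is doubled before it is multiplied by \<^term>\<open>q\<close>: the coefficient of \<^term>\<open>x\<close> is
      then at least 2, and a copy of \<^term>\<open>x\<close> remains after one has been left out.\<close>
  obtain q p where q: "q > 0"
    and p: "\<And>v. v \<in> F \<Longrightarrow> \<bar>of_int q * (2 * u v) - of_int (p v)\<bar> < 1 / N"
    using Dirichlet_approx_simult_finite[OF \<open>finite F\<close> \<open>N > 0\<close>, of "\<lambda>v. 2 * u v"] by metis
  have p_nonneg: "p v \<ge> 0" if "v \<in> F" for v
  proof -
    have "of_int q * (2 * u v) \<ge> 0" using q F(3)[OF that] by simp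
    moreover have "1 / real N \<le> 1" using \<open>N > 0\<close> by simp
    ultimately have "real_of_int (p v) > -1" using p[OF that] by linarith
    then show ?thesis by linarith
  qed
  \<comment> \<open>The coefficient of \<^term>\<open>x\<close>, apart from the sum, is \<open>2 * q - 1\<close>, written as \<open>1 + (2 * q - 2)\<close>
      to keep a copy of \<^term>\<open>x\<close> as the leading summand.\<close>
  define y where "y = x + real (nat (2 * q - 2)) *\<^sub>R x + (\<Sum>v\<in>F. real (nat (p v)) *\<^sub>R v)"
  have "x + real (nat (2 * q - 2)) *\<^sub>R x \<in> S"
    using add_nat_combination_mem[OF add, of "{x}" x "\<lambda>_. nat (2 * q - 2)"] \<open>x \<in> S\<close> by simp
  then have "y \<in> S"
    unfolding y_def using add F(1,2) by (simp add: add_nat_combination_mem)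
  have "(2 * of_int q) *\<^sub>R x = - (\<Sum>v\<in>F. (of_int q * (2 * u v)) *\<^sub>R v)"
  proof -
    have "(\<Sum>v\<in>F. (of_int q * (2 * u v)) *\<^sub>R v) = (2 * of_int q) *\<^sub>R (\<Sum>v\<in>F. u v *\<^sub>R v)"
      by (simp add: scaleR_right.sum mult_ac)
    then show ?thesis by (simp flip: comb)
  qed
  moreover have "y + x = (2 * of_int q) *\<^sub>R x + (\<Sum>v\<in>F. of_int (p v) *\<^sub>R v)"
  proof -
    have "(\<Sum>v\<in>F. real (nat (p v)) *\<^sub>R v) = (\<Sum>v\<in>F. of_int (p v) *\<^sub>R v)"
      using p_nonneg by (intro sum.cong) auto
    moreover have "real (nat (2 * q - 2)) = 2 * of_int q - 2" using q by simp
    ultimately show ?thesis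
      by (simp add: y_def scaleR_left_diff_distrib scaleR_2)
  qed
  ultimately have "y + x = (\<Sum>v\<in>F. (of_int (p v) - of_int q * (2 * u v)) *\<^sub>R v)"
    by (simp add: scaleR_left_diff_distrib sum_subtractf)
  then have "dist y (- x) = norm (\<Sum>v\<in>F. (of_int (p v) - of_int q * (2 * u v)) *\<^sub>R v)"
    by (simp add: dist_norm)
  also have "\<dots> \<le> (\<Sum>v\<in>F. 1 / N * norm v)"
  proof (rule sum_norm_le)
    fix v assume "v \<in> F"
    have "\<bar>of_int (p v) - of_int q * (2 * u v)\<bar> \<le> 1 / N"
      using p[OF \<open>v \<in> F\<close>] by (simp add: abs_minus_commute)
    then show "norm ((of_int (p v) - of_int q * (2 * u v)) *\<^sub>R v) \<le> 1 / N * norm v"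
      unfolding norm_scaleR by (rule mult_right_mono) simp
  qed
  also have "\<dots> = (\<Sum>v\<in>F. norm v) / N" by (simp add: sum_divide_distrib)
  also have "\<dots> < e" using N \<open>e > 0\<close> \<open>N > 0\<close> by (simp add: field_simps)
  finally show "\<exists>y\<in>S. dist y (- x) < e" using \<open>y \<in> S\<close> by blast
qed

lemma convex_cone_closure:
  fixes C :: "'a::real_normed_vector set"
  assumes "convex_cone C"
  shows "convex_cone (closure C)"
proof -
  have "c *\<^sub>R x \<in> closure C" if "x \<in> closure C" "c \<ge> 0" for x c
  proof -
    have "c *\<^sub>R x \<in> closure ((*\<^sub>R) c ` C)"
      using that(1) unfolding closure_scaleR[symmetric] by (rule imageI)
    also have "\<dots> \<subseteq> closure C"
      using assms that by (intro closure_mono) (auto simp: convex_cone_scaleR)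
    finally show ?thesis .
  qed
  then show ?thesis
    using assms by (auto simp: convex_cone_def conic_def convex_closure)
qed

text \<open>
  A finite-dimensional convex set has the same relative interior as its closure, and a subspace is
  its own relative interior.
\<close>

lemma convex_eq_closure_if_subspace_closure:
  fixes C :: "'a::euclidean_space set"
  assumes "convex C" "subspace (closure C)"
  shows "closure C = C"
proof (rule antisym)
  have "closure C = rel_interior (closure C)"
    using assms(2) by (simp add: rel_interior_affine subspace_imp_affine)
  also have "\<dots> = rel_interior C"
    by (rule convex_rel_interior_closure[OF assms(1)])
  also have "\<dots> \<subseteq> C" by (rule rel_interior_subset)
  finally show "closure C \<subseteq> C" .
qed (rule closure_subset)

text \<open>
  A hyperplane separating \<^term>\<open>- x\<close> from the closed cone would give a linear form that is
  nonnegative on \<^term>\<open>S\<close> and positive at \<^term>\<open>x\<close>.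
\<close>

lemma uminus_mem_closure_convex_cone_hull:
  fixes S :: "'a::euclidean_space set"
  assumes balanced: "\<And>l :: 'a \<Rightarrow> real. linear l \<Longrightarrow> \<exists>x\<in>S. l x > 0 \<Longrightarrow> \<exists>x\<in>S. l x < 0"
    and "x \<in> S"
  shows "- x \<in> closure (convex_cone hull S)"
proof (rule ccontr)
  let ?K = "closure (convex_cone hull S)"
  have K: "convex_cone ?K"
    by (intro convex_cone_closure convex_cone_convex_cone_hull)
  have SK: "S \<subseteq> ?K" using closure_subset hull_subset by fast
  assume "- x \<notin> ?K"
  then obtain a b where ab: "a \<bullet> (- x) < b" "\<And>y. y \<in> ?K \<Longrightarrow> a \<bullet> y > b"
    using separating_hyperplane_closed_point[of ?K "- x"] K
    unfolding convex_cone_def by auto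
  \<comment> \<open>The cone contains 0, and scaling a point with negative inner product would bring it onto the
      separating hyperplane.\<close>
  have "b < 0" using ab(2)[OF convex_cone_contains_0[OF K]] by simp
  have nonneg: "a \<bullet> y \<ge> 0" if "y \<in> ?K" for y
  proof (rule ccontr)
    assume neg: "\<not> a \<bullet> y \<ge> 0"
    then have "(b / (a \<bullet> y)) *\<^sub>R y \<in> ?K"
      using \<open>b < 0\<close> that by (intro convex_cone_scaleR[OF K]) (auto simp: divide_nonpos_neg)
    from ab(2)[OF this] neg show False by simp
  qed
  have "a \<bullet> x > 0" using ab(1) \<open>b < 0\<close> by simp
  then obtain y where "y \<in> S" "a \<bullet> y < 0"
    using balanced[of "\<lambda>y. a \<bullet> y"] \<open>x \<in> S\<close>
    by (auto simp: bounded_linear.linear[OF bounded_linear_inner_right])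
  then show False using nonneg SK by force
qed

text \<open>
  The preceding lemma makes the closed cone symmetric, that is, a subspace, and then taking the
  closure has added no points to the cone.
\<close>

lemma uminus_mem_convex_cone_hull:
  fixes S :: "'a::euclidean_space set"
  assumes balanced: "\<And>l :: 'a \<Rightarrow> real. linear l \<Longrightarrow> \<exists>x\<in>S. l x > 0 \<Longrightarrow> \<exists>x\<in>S. l x < 0"
    and "x \<in> S"
  shows "- x \<in> convex_cone hull S"
proof -
  let ?C = "convex_cone hull S"
  have K: "convex_cone (closure ?C)"
    by (intro convex_cone_closure convex_cone_convex_cone_hull)
  have "convex_cone (uminus ` closure ?C)"
    using K by (rule convex_cone_negations)
  moreover have "S \<subseteq> uminus ` closure ?C"
    using uminus_mem_closure_convex_cone_hull[OF balanced]
    by (auto simp: image_iff) (metis minus_minus)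
  ultimately have "?C \<subseteq> uminus ` closure ?C" by (intro hull_minimal)
  then have "closure ?C \<subseteq> uminus ` closure ?C"
    by (intro closure_minimal) (auto intro: closed_negations)
  then have "- y \<in> closure ?C" if "y \<in> closure ?C" for y
    using that by fastforce
  then have "subspace (closure ?C)"
    using K by (simp add: subspace_convex_cone_symmetric)
  then have "closure ?C = ?C"
    by (intro convex_eq_closure_if_subspace_closure convex_convex_cone_hull)
  then show ?thesis
    using uminus_mem_closure_convex_cone_hull[OF assms] by simp
qed

lemma add_mem_closure:
  fixes S :: "'a::real_normed_vector set"
  assumes "\<And>x y. x \<in> S \<Longrightarrow> y \<in> S \<Longrightarrow> x + y \<in> S"
    and "x \<in> closure S" "y \<in> closure S"
  shows "x + y \<in> closure S"
proof -
  obtain f g where "\<And>n. f n \<in> S" "f \<longlonglongrightarrow> x" "\<And>n. g n \<in> S" "g \<longlonglongrightarrow> y"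
    using assms by (metis closure_sequential)
  then have "(\<forall>n. f n + g n \<in> S) \<and> (\<lambda>n. f n + g n) \<longlonglongrightarrow> x + y"
    using assms(1) by (simp add: tendsto_add)
  then show ?thesis unfolding closure_sequential by (rule exI[where x = "\<lambda>n. f n + g n"])
qed

lemma subgroup_closure_additive_groupI:
  fixes S :: "'a::real_normed_vector set"
  assumes "S \<noteq> {}"
    and add: "\<And>x y. x \<in> S \<Longrightarrow> y \<in> S \<Longrightarrow> x + y \<in> S"
    and uminus: "\<And>x. x \<in> S \<Longrightarrow> - x \<in> closure S"
  shows "subgroup (closure S) additive_group"
proof -
  interpret group "additive_group :: 'a monoid" by (rule group_additive_group)
  have closure_uminus: "- x \<in> closure S" if "x \<in> closure S" for x
  proof -
    have "closure S \<subseteq> uminus ` closure S"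
      using uminus by (intro closure_minimal closed_negations) (force simp: image_iff)+
    then show ?thesis using that by fastforce
  qed
  show ?thesis
  proof (rule subgroupI)
    fix x assume x: "x \<in> closure S"
    have "inv\<^bsub>additive_group\<^esub> x = - x"
      by (rule inv_equality) (auto simp: additive_group_def)
    then show "inv\<^bsub>additive_group\<^esub> x \<in> closure S"
      using closure_uminus[OF x] by simp
  qed (use assms add_mem_closure[OF add] in \<open>auto simp: additive_group_def\<close>)
qed

theorem theorem2p1:
  fixes S :: "(real ^ 'n) set"
  assumes "S \<noteq> {}"
    and "subsemigroup S additive_group"
    and "\<And>l :: real ^ 'n \<Rightarrow> real. linear l \<Longrightarrow> \<exists>x\<in>S. l x > 0 \<Longrightarrow> \<exists>x\<in>S. l x < 0"
  shows "subgroup (closure S) additive_group"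
proof (rule subgroup_closure_additive_groupI[OF assms(1)])
  show add: "x + y \<in> S" if "x \<in> S" "y \<in> S" for x y
    using assms(2) that by (simp add: subsemigroup_additive_group_iff)
  show "- x \<in> closure S" if "x \<in> S" for x
    using uminus_mem_closure_if_uminus_mem_cone[OF add that]
      uminus_mem_convex_cone_hull[OF assms(3) that] by blast
qed

end
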